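(* Let $\mathbf{KH}^{op}$ be the dual (opposite) of the category of compact Hausdorff spaces and continuous maps. Then $\mathbf{KH}^{op}$ is not an abstract elementary category.
   Context: A category $\mathcal{K}$ is an abstract elementary category if: (1) $\mathcal{K}$ is accessible and has all directed colimits; and (2) there is an embedding of categories $F:\mathcal{K}\to\mathcal{L}$ (a faithful functor, injective on objects), with $\mathcal{L}$ a finitely accessible category, such that: (a) $F$ is iso-full: every isomorphism $f:FA\to FB$ in $\mathcal{L}$ is of the form $F(\bar f)$ for some $\bar f:A\to B$ in $\mathcal{K}$; (b) $F$ is coherent: whenever $h:A\to C$ and $g:B\to C$ are morphisms of $\mathcal{K}$ and $f:FA\to FB$ is a morphism of $\mathcal{L}$ with $F(g)\circ f=F(h)$, there is $\bar f:A\to B$ in $\mathcal{K}$ with $F(\bar f)=f$; (c) $F$ preserves directed colimits. *)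

theory Defs
  imports "HOL-Analysis.T1_Spaces" "HOL-Library.FuncSet"
begin

unbundle cardinal_syntax

section \<open>Universes and smallness\<close>

text \<open>
  The ambient class of all sets is modelled by a type \<open>'u\<close> whose cardinality is an uncountable
  strongly inaccessible cardinal (so that \<open>'u\<close> is in bijection with a Grothendieck universe; the
  type of all sets of a ZFC-like extension of HOL qualifies as well).  ``Sets'' in the sense
  of the set/class distinction are then the collections of cardinality smaller than that of
  \<open>'u\<close>; ``classes'' are collections that inject into \<open>'u\<close>.
\<close>

definition small :: "'u itself \<Rightarrow> 'a set \<Rightarrow> bool" where
  "small U A \<longleftrightarrow> |A| <o |UNIV :: 'u set|"

definition universe :: "'u itself \<Rightarrow> bool" where
  "universe U \<longleftrightarrow>
     small U (UNIV :: nat set) \<and>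
     regularCard |UNIV :: 'u set| \<and>
     (\<forall>A :: 'u set. small U A \<longrightarrow> small U (Pow A))"


section \<open>Categories and functors\<close>

record ('o, 'a) cat =
  Obj :: "'o set"
  Arr :: "'a set"
  Dom :: "'a \<Rightarrow> 'o"
  Cod :: "'a \<Rightarrow> 'o"
  Id :: "'o \<Rightarrow> 'a"
  Comp :: "'a \<Rightarrow> 'a \<Rightarrow> 'a"  \<comment> \<open>\<open>Comp C g f\<close> is \<open>g\<close> after \<open>f\<close>\<close>

definition hom :: "('o, 'a) cat \<Rightarrow> 'o \<Rightarrow> 'o \<Rightarrow> 'a set" where
  "hom C A B = {f \<in> Arr C. Dom C f = A \<and> Cod C f = B}"

definition category :: "('o, 'a) cat \<Rightarrow> bool" where
  "category C \<longleftrightarrow>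
     (\<forall>f\<in>Arr C. Dom C f \<in> Obj C \<and> Cod C f \<in> Obj C) \<and>
     (\<forall>A\<in>Obj C. Id C A \<in> hom C A A) \<and>
     (\<forall>A B D. \<forall>f\<in>hom C A B. \<forall>g\<in>hom C B D. Comp C g f \<in> hom C A D) \<and>
     (\<forall>A B. \<forall>f\<in>hom C A B. Comp C f (Id C A) = f \<and> Comp C (Id C B) f = f) \<and>
     (\<forall>A B D E. \<forall>f\<in>hom C A B. \<forall>g\<in>hom C B D. \<forall>h\<in>hom C D E.
        Comp C h (Comp C g f) = Comp C (Comp C h g) f)"

definition locally_small :: "'u itself \<Rightarrow> ('o, 'a) cat \<Rightarrow> bool" where
  "locally_small U C \<longleftrightarrow> (\<forall>A\<in>Obj C. \<forall>B\<in>Obj C. small U (hom C A B))"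

definition opposite :: "('o, 'a) cat \<Rightarrow> ('o, 'a) cat" where
  "opposite C =
     \<lparr>Obj = Obj C, Arr = Arr C, Dom = Cod C, Cod = Dom C, Id = Id C,
      Comp = (\<lambda>g f. Comp C f g)\<rparr>"

definition isomorphism :: "('o, 'a) cat \<Rightarrow> 'o \<Rightarrow> 'o \<Rightarrow> 'a \<Rightarrow> bool" where
  "isomorphism C A B f \<longleftrightarrow>
     f \<in> hom C A B \<and> (\<exists>g\<in>hom C B A. Comp C g f = Id C A \<and> Comp C f g = Id C B)"

definition is_functor ::
  "('o, 'a) cat \<Rightarrow> ('p, 'b) cat \<Rightarrow> ('o \<Rightarrow> 'p) \<Rightarrow> ('a \<Rightarrow> 'b) \<Rightarrow> bool" where
  "is_functor C D Fo Fa \<longleftrightarrow>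
     category C \<and> category D \<and>
     (\<forall>A\<in>Obj C. Fo A \<in> Obj D) \<and>
     (\<forall>A B. \<forall>f\<in>hom C A B. Fa f \<in> hom D (Fo A) (Fo B)) \<and>
     (\<forall>A\<in>Obj C. Fa (Id C A) = Id D (Fo A)) \<and>
     (\<forall>A B E. \<forall>f\<in>hom C A B. \<forall>g\<in>hom C B E. Fa (Comp C g f) = Comp D (Fa g) (Fa f))"

definition faithful :: "('o, 'a) cat \<Rightarrow> ('a \<Rightarrow> 'b) \<Rightarrow> bool" where
  "faithful C Fa \<longleftrightarrow> (\<forall>A\<in>Obj C. \<forall>B\<in>Obj C. inj_on Fa (hom C A B))"

definition embedding ::
  "('o, 'a) cat \<Rightarrow> ('p, 'b) cat \<Rightarrow> ('o \<Rightarrow> 'p) \<Rightarrow> ('a \<Rightarrow> 'b) \<Rightarrow> bool" where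
  "embedding C D Fo Fa \<longleftrightarrow> is_functor C D Fo Fa \<and> faithful C Fa \<and> inj_on Fo (Obj C)"


section \<open>Directed colimits\<close>

text \<open>
  Infinite cardinals are represented, as in the library, by cardinal orders; \<^term>\<open>natLeq\<close>
  is \<open>\<aleph>\<^sub>0\<close>, and \<^term>\<open>natLeq\<close>-directed posets are the directed ones.
  Taking \<open>S = {}\<close> shows that directed posets are nonempty.
\<close>

definition directed_poset :: "'c rel \<Rightarrow> 'i set \<Rightarrow> 'i rel \<Rightarrow> bool" where
  "directed_poset l I r \<longleftrightarrow>
     partial_order_on I r \<and>
     (\<forall>S. S \<subseteq> I \<and> |S| <o l \<longrightarrow> (\<exists>b\<in>I. \<forall>s\<in>S. (s, b) \<in> r))"

definition diagram ::
  "('o, 'a) cat \<Rightarrow> 'i set \<Rightarrow> 'i rel \<Rightarrow> ('i \<Rightarrow> 'o) \<Rightarrow> ('i \<Rightarrow> 'i \<Rightarrow> 'a) \<Rightarrow> bool" where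
  "diagram C I r Do Da \<longleftrightarrow>
     (\<forall>i\<in>I. Do i \<in> Obj C) \<and>
     (\<forall>(i, j)\<in>r. Da i j \<in> hom C (Do i) (Do j)) \<and>
     (\<forall>i\<in>I. Da i i = Id C (Do i)) \<and>
     (\<forall>i j k. (i, j) \<in> r \<and> (j, k) \<in> r \<longrightarrow> Comp C (Da j k) (Da i j) = Da i k)"

definition cocone ::
  "('o, 'a) cat \<Rightarrow> 'i set \<Rightarrow> 'i rel \<Rightarrow> ('i \<Rightarrow> 'o) \<Rightarrow> ('i \<Rightarrow> 'i \<Rightarrow> 'a) \<Rightarrow> 'o \<Rightarrow> ('i \<Rightarrow> 'a) \<Rightarrow> bool" where
  "cocone C I r Do Da X c \<longleftrightarrow>
     X \<in> Obj C \<and>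
     (\<forall>i\<in>I. c i \<in> hom C (Do i) X) \<and>
     (\<forall>(i, j)\<in>r. Comp C (c j) (Da i j) = c i)"

definition colimit ::
  "('o, 'a) cat \<Rightarrow> 'i set \<Rightarrow> 'i rel \<Rightarrow> ('i \<Rightarrow> 'o) \<Rightarrow> ('i \<Rightarrow> 'i \<Rightarrow> 'a) \<Rightarrow> 'o \<Rightarrow> ('i \<Rightarrow> 'a) \<Rightarrow> bool" where
  "colimit C I r Do Da X c \<longleftrightarrow>
     cocone C I r Do Da X c \<and>
     (\<forall>Y d. cocone C I r Do Da Y d \<longrightarrow>
        (\<exists>!h. h \<in> hom C X Y \<and> (\<forall>i\<in>I. Comp C h (c i) = d i)))"

text \<open>Every small poset has an isomorphic copy on a subset of \<open>'u\<close>, so these suffice as index sets.\<close>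

definition has_directed_colimits :: "'u itself \<Rightarrow> 'c rel \<Rightarrow> ('o, 'a) cat \<Rightarrow> bool" where
  "has_directed_colimits U l C \<longleftrightarrow>
     (\<forall>(I :: 'u set) r Do Da.
        small U I \<and> directed_poset l I r \<and> diagram C I r Do Da \<longrightarrow>
        (\<exists>X c. colimit C I r Do Da X c))"

definition preserves_directed_colimits ::
  "'u itself \<Rightarrow> 'c rel \<Rightarrow> ('o, 'a) cat \<Rightarrow> ('p, 'b) cat \<Rightarrow> ('o \<Rightarrow> 'p) \<Rightarrow> ('a \<Rightarrow> 'b) \<Rightarrow> bool" where
  "preserves_directed_colimits U l C D Fo Fa \<longleftrightarrow>
     (\<forall>(I :: 'u set) r Do Da X c.
        small U I \<and> directed_poset l I r \<and> diagram C I r Do Da \<and> colimit C I r Do Da X c \<longrightarrow>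
        colimit D I r (\<lambda>i. Fo (Do i)) (\<lambda>i j. Fa (Da i j)) (Fo X) (\<lambda>i. Fa (c i)))"


section \<open>The category of sets and hom-functors\<close>

definition set_cat :: "'u itself \<Rightarrow> ('b set, 'b set \<times> 'b set \<times> ('b \<Rightarrow> 'b)) cat" where
  "set_cat U =
     \<lparr>Obj = {S. small U S},
      Arr = {(S, T, f). small U S \<and> small U T \<and> f \<in> S \<rightarrow>\<^sub>E T},
      Dom = (\<lambda>(S, T, f). S),
      Cod = (\<lambda>(S, T, f). T),
      Id = (\<lambda>S. (S, S, \<lambda>x\<in>S. x)),
      Comp = (\<lambda>(S', T', g) (S, T, f). (S, T', compose S g f))\<rparr>"

text \<open>
  The hom-functors take values in small subsets of \<open>'a + 'u\<close> rather than of \<open>'a\<close>: the type \<open>'a\<close>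
  of arrows may be too poor (e.g. finite) for its small subsets to represent all small sets,
  whereas those of \<open>'a + 'u\<close> do.
\<close>

definition hom_obj :: "'u itself \<Rightarrow> ('o, 'a) cat \<Rightarrow> 'o \<Rightarrow> 'o \<Rightarrow> ('a + 'u) set" where
  "hom_obj U C A X = Inl ` hom C A X"

definition hom_arr ::
  "'u itself \<Rightarrow> ('o, 'a) cat \<Rightarrow> 'o \<Rightarrow> 'a
     \<Rightarrow> ('a + 'u) set \<times> ('a + 'u) set \<times> ('a + 'u \<Rightarrow> 'a + 'u)" where
  "hom_arr U C A f =
     (hom_obj U C A (Dom C f), hom_obj U C A (Cod C f),
      \<lambda>x\<in>hom_obj U C A (Dom C f). Inl (Comp C f (projl x)))"


section \<open>Accessible categories\<close>

definition presentable :: "'u itself \<Rightarrow> 'c rel \<Rightarrow> ('o, 'a) cat \<Rightarrow> 'o \<Rightarrow> bool" where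
  "presentable U l C A \<longleftrightarrow>
     A \<in> Obj C \<and>
     preserves_directed_colimits U l C
       (set_cat U :: (('a + 'u) set, _) cat) (hom_obj U C A) (hom_arr U C A)"

definition accessible_at :: "'u itself \<Rightarrow> 'c rel \<Rightarrow> ('o, 'a) cat \<Rightarrow> bool" where
  "accessible_at U l C \<longleftrightarrow>
     category C \<and> locally_small U C \<and>
     has_directed_colimits U l C \<and>
     (\<exists>P. small U P \<and> (\<forall>A\<in>P. presentable U l C A) \<and>
        (\<forall>X\<in>Obj C. \<exists>(I :: 'u set) r Do Da c.
           small U I \<and> directed_poset l I r \<and> diagram C I r Do Da \<and>
           (\<forall>i\<in>I. Do i \<in> P) \<and> colimit C I r Do Da X c))"

text \<open>
  Every small infinite cardinal is represented by a cardinal order on some subset of \<open>'u\<close>.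
\<close>

definition accessible :: "'u itself \<Rightarrow> ('o, 'a) cat \<Rightarrow> bool" where
  "accessible U C \<longleftrightarrow>
     (\<exists>l :: 'u rel. Cinfinite l \<and> regularCard l \<and> small U (Field l) \<and> accessible_at U l C)"

definition finitely_accessible :: "'u itself \<Rightarrow> ('o, 'a) cat \<Rightarrow> bool" where
  "finitely_accessible U C \<longleftrightarrow> accessible_at U natLeq C"


section \<open>Abstract elementary categories\<close>

definition iso_full ::
  "('o, 'a) cat \<Rightarrow> ('p, 'b) cat \<Rightarrow> ('o \<Rightarrow> 'p) \<Rightarrow> ('a \<Rightarrow> 'b) \<Rightarrow> bool" where
  "iso_full K L Fo Fa \<longleftrightarrow>
     (\<forall>A\<in>Obj K. \<forall>B\<in>Obj K. \<forall>f. isomorphism L (Fo A) (Fo B) f \<longrightarrow>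
        (\<exists>f'\<in>hom K A B. Fa f' = f))"

definition coherent ::
  "('o, 'a) cat \<Rightarrow> ('p, 'b) cat \<Rightarrow> ('o \<Rightarrow> 'p) \<Rightarrow> ('a \<Rightarrow> 'b) \<Rightarrow> bool" where
  "coherent K L Fo Fa \<longleftrightarrow>
     (\<forall>A\<in>Obj K. \<forall>B\<in>Obj K. \<forall>D\<in>Obj K.
        \<forall>h\<in>hom K A D. \<forall>g\<in>hom K B D. \<forall>f\<in>hom L (Fo A) (Fo B).
        Comp L (Fa g) f = Fa h \<longrightarrow> (\<exists>f'\<in>hom K A B. Fa f' = f))"

text \<open>
  As \<open>'u\<close> plays the role of the class of all sets, the objects and the arrows of an arbitrary
  category (with a class of objects and a class of arrows) may be taken to be elements of \<open>'u\<close>;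
  this is how the quantification over all finitely accessible categories is expressed.
\<close>

definition abstract_elementary_category :: "'u itself \<Rightarrow> ('o, 'a) cat \<Rightarrow> bool" where
  "abstract_elementary_category U K \<longleftrightarrow>
     accessible U K \<and> has_directed_colimits U natLeq K \<and>
     (\<exists>(L :: ('u, 'u) cat) Fo Fa.
        finitely_accessible U L \<and>
        embedding K L Fo Fa \<and>
        iso_full K L Fo Fa \<and>
        coherent K L Fo Fa \<and>
        preserves_directed_colimits U natLeq K L Fo Fa)"


section \<open>Compact Hausdorff spaces\<close>

definition KH_obj :: "'u itself \<Rightarrow> 'u topology set" where
  "KH_obj U = {X. small U (topspace X) \<and> compact_space X \<and> Hausdorff_space X}"

text \<open>Maps are made extensional so that equality of arrows is equality on the points of the domain.\<close>

definition KH :: "'u itself \<Rightarrow> ('u topology, 'u topology \<times> 'u topology \<times> ('u \<Rightarrow> 'u)) cat" where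
  "KH U =
     \<lparr>Obj = KH_obj U,
      Arr = {(X, Y, f). X \<in> KH_obj U \<and> Y \<in> KH_obj U \<and>
                        continuous_map X Y f \<and> f \<in> extensional (topspace X)},
      Dom = (\<lambda>(X, Y, f). X),
      Cod = (\<lambda>(X, Y, f). Y),
      Id = (\<lambda>X. (X, X, \<lambda>x\<in>topspace X. x)),
      Comp = (\<lambda>(X', Y', g) (X, Y, f). (X, Y', compose (topspace X) g f))\<rparr>"

lemma category_opposite: "category C \<Longrightarrow> category (opposite C)"
  unfolding category_def opposite_def hom_def by auto

lemma category_set_cat: "category (set_cat U)"
  unfolding category_def set_cat_def hom_def
  by (auto simp: compose_def PiE_iff extensional_def fun_eq_iff)

lemma category_KH: "category (KH U)"
proof -
  have comp: "continuous_map X Z (compose (topspace X) g f)"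
    if "continuous_map X Y f" "continuous_map Y Z g" for X Y Z :: "'a topology" and f g
    using continuous_map_compose[OF that] by (rule continuous_map_eq) (simp add: compose_def)
  have ident: "continuous_map X X (\<lambda>x\<in>topspace X. x)" for X :: "'a topology"
    by (rule continuous_map_eq[OF continuous_map_id]) simp
  have maps: "f x \<in> topspace Y" if "continuous_map X Y f" "x \<in> topspace X"
    for X Y :: "'a topology" and f x
    using that by (auto simp: continuous_map_def)
  show ?thesis
    unfolding category_def KH_def hom_def
    using comp ident by (auto simp: compose_def extensional_def fun_eq_iff maps)
qed

end

theory Submission
  imports Defs "HOL-Analysis.Path_Connected"
begin

text \<open>
  Faithfulness of \<open>F : KH\<^sup>o\<^sup>p \<rightarrow> L\<close> and preservation of colimits of chains already contradict each other.
  Let \<open>A\<close> be finitely presentable in \<open>L\<close>. A morphism \<open>y : A \<rightarrow> F X\<close> colours every point \<open>t : 1 \<rightarrow> X\<close>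
  of \<open>X\<close> by \<open>F t \<circ> y : A \<rightarrow> F 1\<close>. If \<open>\<pi> : X \<rightarrow> X\<close> is constant with value \<open>p\<close>, then \<open>y\<close> and \<open>F \<pi> \<circ> y\<close>
  give \<open>p\<close> the same colour. As \<open>{p}\<close> is the limit of its closed neighbourhoods \<open>N\<^sub>n\<close>, they already agree
  in some \<open>hom(A, F N\<^sub>n)\<close>, so that \<open>y\<close> gives all points of \<open>N\<^sub>n\<close> the colour of \<open>p\<close>. Hence colourings are
  locally constant, and constant on \<open>X = [0, 1]\<close>. But the end points give distinct morphisms \<open>F X \<rightarrow> F 1\<close>, and \<open>F X\<close> is a
  colimit of finitely presentable objects, so some \<open>y\<close> gives different colours to the end points.
\<close>

section \<open>Finitely presentable objects\<close>

lemma small_finite: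
  assumes "universe TYPE('u)" "finite A"
  shows "small TYPE('u) A"
proof -
  have "|A| <o |UNIV :: nat set|"
    using assms(2) by (meson finite_iff_ordLess_natLeq card_of_nat ordIso_symmetric ordLess_ordIso_trans)
  then show ?thesis
    using assms(1) ordLess_transitive unfolding universe_def small_def by blast
qed

lemma directed_posetE:
  assumes "directed_poset natLeq I r" "i \<in> I" "j \<in> I"
  obtains k where "(i, k) \<in> r" "(j, k) \<in> r"
proof -
  have "|{i, j}| <o natLeq"
    by (simp flip: finite_iff_ordLess_natLeq)
  then obtain k where "\<forall>s\<in>{i, j}. (s, k) \<in> r"
    using assms unfolding directed_poset_def by (metis empty_subsetI insert_subset)
  then show thesis
    using that by blast
qed

lemma Comp_in_hom:
  assumes "category C" "f \<in> hom C A B" "g \<in> hom C B D"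
  shows "Comp C g f \<in> hom C A D"
  using assms unfolding category_def by blast

lemma Comp_assoc:
  assumes "category C" "f \<in> hom C A B" "g \<in> hom C B D" "h \<in> hom C D E"
  shows "Comp C h (Comp C g f) = Comp C (Comp C h g) f"
  using assms unfolding category_def by blast

lemma set_cat_Comp:
  "Comp (set_cat U) (S', T', g) (S, T, f) = (S, T', compose S g f)"
  by (simp add: set_cat_def)

lemma set_cat_hom:
  "h \<in> hom (set_cat U) S T \<longleftrightarrow>
     small U S \<and> small U T \<and> (\<exists>f. h = (S, T, f) \<and> f \<in> S \<rightarrow>\<^sub>E T)"
  by (auto simp: hom_def set_cat_def)

lemma hom_arr_eq:
  assumes "f \<in> hom C B D"
  shows "hom_arr U C A f =
    (hom_obj U C A B, hom_obj U C A D, \<lambda>x\<in>hom_obj U C A B. Inl (Comp C f (projl x)))"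
  using assms by (simp add: hom_arr_def hom_def)

text \<open>The hom-functor of \<open>A\<close> turns the colimit into one of sets, where two
  elements of a stage become equal only if a later stage already identifies them. This follows from
  the universal property alone: otherwise a two-valued cocone would separate \<open>x\<close> from
  \<open>y\<close>, although its factorisation sees only their equal composites with
  \<open>c i\<close>.\<close>

lemma presentable_colimit_eq:
  fixes L :: "('o, 'a) cat" and I :: "'u set"
  assumes U: "universe TYPE('u)" and L: "category L"
    and I: "small TYPE('u) I" and dir: "directed_poset natLeq I r"
    and dia: "diagram L I r Do Da" and col: "colimit L I r Do Da X c"
    and A: "presentable TYPE('u) natLeq L A"
    and i: "i \<in> I" and x: "x \<in> hom L A (Do i)" and y: "y \<in> hom L A (Do i)"
    and eq: "Comp L (c i) x = Comp L (c i) y"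
  shows "\<exists>j. (i, j) \<in> r \<and> Comp L (Da i j) x = Comp L (Da i j) y"
proof (rule ccontr)
  assume neq: "\<not> ?thesis"
  let ?S = "set_cat TYPE('u) :: (('a + 'u) set, _) cat"
  let ?H = "hom_obj TYPE('u) L A" and ?h = "hom_arr TYPE('u) L A"
  have po: "partial_order_on I r"
    using dir by (simp add: directed_poset_def)
  have rI: "j \<in> I" "k \<in> I" if "(j, k) \<in> r" for j k
    using po that unfolding partial_order_on_def preorder_on_def refl_on_def by blast+
  have refl: "(j, j) \<in> r" if "j \<in> I" for j
    using po that unfolding partial_order_on_def preorder_on_def refl_on_def by blast
  have trans: "(j, l) \<in> r" if "(j, k) \<in> r" "(k, l) \<in> r" for j k l
    using po that unfolding partial_order_on_def preorder_on_def trans_def by blast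
  have Da: "Da j k \<in> hom L (Do j) (Do k)" if "(j, k) \<in> r" for j k
    using dia that by (auto simp: diagram_def)
  have DaDa: "Comp L (Da k l) (Da j k) = Da j l" if "(j, k) \<in> r" "(k, l) \<in> r" for j k l
    using dia that by (auto simp: diagram_def)
  have DaDa': "Comp L (Da k l) (Comp L (Da j k) z) = Comp L (Da j l) z"
    if "(j, k) \<in> r" "(k, l) \<in> r" "z \<in> hom L A (Do j)" for j k l z
    using Comp_assoc[OF L that(3) Da[OF that(1)] Da[OF that(2)]] DaDa[OF that(1,2)] by simp
  have c: "c j \<in> hom L (Do j) X" if "j \<in> I" for j
    using col that by (auto simp: colimit_def cocone_def)
  have colS: "colimit ?S I r (\<lambda>j. ?H (Do j)) (\<lambda>j k. ?h (Da j k)) (?H X) (\<lambda>j. ?h (c j))"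
    using A I dir dia col unfolding presentable_def preserves_directed_colimits_def by blast
  then have smallH: "small TYPE('u) (?H (Do j))" if "j \<in> I" for j
    using that by (auto simp: colimit_def cocone_def set_cat_hom)
  \<comment> \<open>Two truth values; taking them from different summands makes them distinct even
    if \<open>'a\<close> has a single element.\<close>
  define p q :: "'a + 'u" where "p = Inl undefined" and "q = Inr undefined"
  have pq: "p \<noteq> q"
    by (simp add: p_def q_def)
  \<comment> \<open>\<open>Q j z\<close> says that \<open>z\<close> and \<open>x\<close> become equal at a later stage; it is compatible with the
    transition maps, so its truth value is a cocone, and it separates \<open>x\<close> from \<open>y\<close>.\<close>
  define Q where
    "Q j z \<longleftrightarrow> (\<exists>k. (j, k) \<in> r \<and> (i, k) \<in> r \<and> Comp L (Da j k) z = Comp L (Da i k) x)" for j z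
  define d where "d j = (?H (Do j), {p, q}, \<lambda>w\<in>?H (Do j). if Q j (projl w) then p else q)" for j
  have Q: "Q k (Comp L (Da j k) z) \<longleftrightarrow> Q j z"
    if jk: "(j, k) \<in> r" and z: "z \<in> hom L A (Do j)" for j k z
  proof
    assume "Q k (Comp L (Da j k) z)"
    then show "Q j z"
      unfolding Q_def using DaDa'[OF jk _ z] trans[OF jk] by metis
  next
    assume "Q j z"
    then obtain l where l: "(j, l) \<in> r" "(i, l) \<in> r" "Comp L (Da j l) z = Comp L (Da i l) x"
      unfolding Q_def by blast
    obtain m where m: "(k, m) \<in> r" "(l, m) \<in> r"
      using directed_posetE[OF dir rI(2)[OF jk] rI(2)[OF l(1)]] .
    have "Comp L (Da k m) (Comp L (Da j k) z) = Comp L (Da j m) z"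
      using DaDa'[OF jk m(1) z] .
    also have "\<dots> = Comp L (Da l m) (Comp L (Da j l) z)"
      using DaDa'[OF l(1) m(2) z] by simp
    also have "\<dots> = Comp L (Da i m) x"
      using l(3) DaDa'[OF l(2) m(2) x] by simp
    finally show "Q k (Comp L (Da j k) z)"
      unfolding Q_def using m trans[OF l(2) m(2)] by blast
  qed
  have "cocone ?S I r (\<lambda>j. ?H (Do j)) (\<lambda>j k. ?h (Da j k)) {p, q} d"
    unfolding cocone_def
  proof (intro conjI ballI; clarify?)
    show "{p, q} \<in> Obj ?S"
      by (simp add: set_cat_def small_finite[OF U])
  next
    fix j assume "j \<in> I"
    then show "d j \<in> hom ?S (?H (Do j)) {p, q}"
      by (auto simp: set_cat_hom d_def smallH small_finite[OF U])
  next
    fix j k assume jk: "(j, k) \<in> r"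
    have "Comp L (Da j k) z \<in> hom L A (Do k)" if "z \<in> hom L A (Do j)" for z
      using Comp_in_hom[OF L that Da[OF jk]] .
    then show "Comp ?S (d k) (?h (Da j k)) = d j"
      using Q[OF jk]
      by (auto simp: hom_arr_eq[OF Da[OF jk]] d_def set_cat_Comp compose_def hom_obj_def fun_eq_iff)
  qed
  then obtain h where h: "h \<in> hom ?S (?H X) {p, q}" "\<And>j. j \<in> I \<Longrightarrow> Comp ?S h (?h (c j)) = d j"
    using colS unfolding colimit_def by blast
  then obtain h' where h': "h = (?H X, {p, q}, h')"
    by (auto simp: set_cat_hom)
  have "h' (Inl (Comp L (c i) z)) = (if Q i z then p else q)" if "z \<in> hom L A (Do i)" for z
  proof -
    have "compose (?H (Do i)) h' (\<lambda>w\<in>?H (Do i). Inl (Comp L (c i) (projl w)))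
        = (\<lambda>w\<in>?H (Do i). if Q i (projl w) then p else q)"
      using h(2)[OF i] by (simp add: h' hom_arr_eq[OF c[OF i]] set_cat_Comp d_def)
    from fun_cong[OF this, of "Inl z"] show ?thesis
      using that by (simp add: compose_def hom_obj_def)
  qed
  \<comment> \<open>By \<open>eq\<close>, the factorisation \<open>h'\<close> is evaluated at the
    same element for \<open>x\<close> and for \<open>y\<close>.\<close>
  from this[OF x] this[OF y] have "Q i x \<longleftrightarrow> Q i y"
    using eq pq by (auto split: if_splits)
  moreover have "Q i x"
    unfolding Q_def using refl[OF i] by blast
  moreover have "\<not> Q i y"
    using neq unfolding Q_def by metis
  ultimately show False
    by blast
qed

section \<open>Uniqueness for colimit cocones; functors acting on diagrams\<close>

text \<open>Both arrows factor the one cocone \<open>\<lambda>i. Comp C f (c i)\<close> through the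
  colimit.\<close>

lemma colimit_jointly_epic:
  assumes C: "category C" and dia: "diagram C I r Do Da" and col: "colimit C I r Do Da X c"
    and I: "r \<subseteq> I \<times> I"
    and f: "f \<in> hom C X Y" and g: "g \<in> hom C X Y"
    and eq: "\<And>i. i \<in> I \<Longrightarrow> Comp C f (c i) = Comp C g (c i)"
  shows "f = g"
proof -
  have c: "c i \<in> hom C (Do i) X" if "i \<in> I" for i
    using col that by (auto simp: colimit_def cocone_def)
  have "cocone C I r Do Da Y (\<lambda>i. Comp C f (c i))"
    unfolding cocone_def
  proof (intro conjI ballI; clarify?)
    show "Y \<in> Obj C"
      using C f by (auto simp: category_def hom_def)
    show "Comp C f (c i) \<in> hom C (Do i) Y" if "i \<in> I" for i
      using Comp_in_hom[OF C c[OF that] f] .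
    show "Comp C (Comp C f (c j)) (Da i j) = Comp C f (c i)" if "(i, j) \<in> r" for i j
    proof -
      have "Da i j \<in> hom C (Do i) (Do j)" "j \<in> I"
        using dia I that by (auto simp: diagram_def)
      moreover have "Comp C (c j) (Da i j) = c i"
        using col that by (auto simp: colimit_def cocone_def)
      ultimately show ?thesis
        using Comp_assoc[OF C _ c f] by metis
    qed
  qed
  then have "\<exists>!h. h \<in> hom C X Y \<and> (\<forall>i\<in>I. Comp C h (c i) = Comp C f (c i))"
    using col by (simp add: colimit_def)
  then show ?thesis
    using f g eq by metis
qed

lemma functor_Comp:
  assumes "is_functor C D Fo Fa" "f \<in> hom C A B" "g \<in> hom C B E" "y \<in> hom D W (Fo A)"
  shows "Comp D (Fa g) (Comp D (Fa f) y) = Comp D (Fa (Comp C g f)) y"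
proof -
  have "Fa f \<in> hom D (Fo A) (Fo B)" "Fa g \<in> hom D (Fo B) (Fo E)" "category D"
    "Fa (Comp C g f) = Comp D (Fa g) (Fa f)"
    using assms unfolding is_functor_def by blast+
  then show ?thesis
    using Comp_assoc assms(4) by metis
qed

lemma functor_diagram:
  assumes F: "is_functor C D Fo Fa" and dia: "diagram C I r Do Da"
  shows "diagram D I r (\<lambda>i. Fo (Do i)) (\<lambda>i j. Fa (Da i j))"
  unfolding diagram_def
proof (intro conjI allI ballI impI; clarify?)
  fix i j k assume ij: "(i, j) \<in> r" "(j, k) \<in> r"
  then have "Da i j \<in> hom C (Do i) (Do j)" "Da j k \<in> hom C (Do j) (Do k)"
    using dia by (auto simp: diagram_def)
  then have "Fa (Comp C (Da j k) (Da i j)) = Comp D (Fa (Da j k)) (Fa (Da i j))"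
    using F unfolding is_functor_def by blast
  then show "Comp D (Fa (Da j k)) (Fa (Da i j)) = Fa (Da i k)"
    using dia ij by (auto simp: diagram_def)
qed (use F dia in \<open>auto simp: is_functor_def diagram_def\<close>)

section \<open>Compact Hausdorff spaces\<close>

text \<open>Restriction yields the extensional representative that \<open>KH\<close> demands, so
  \<open>f\<close> may be any function continuous on \<open>X\<close>, whatever its values
  elsewhere.\<close>

definition kmap :: "'u topology \<Rightarrow> 'u topology \<Rightarrow> ('u \<Rightarrow> 'u) \<Rightarrow> 'u topology \<times> 'u topology \<times> ('u \<Rightarrow> 'u)" where
  "kmap X Y f = (X, Y, restrict f (topspace X))"

lemma kmap_eq_iff: "kmap X Y f = kmap X Y g \<longleftrightarrow> (\<forall>x\<in>topspace X. f x = g x)"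
  by (auto simp: kmap_def restrict_def fun_eq_iff)

lemma hom_opposite_KH:
  "a \<in> hom (opposite (KH U)) Y X \<longleftrightarrow>
     X \<in> KH_obj U \<and> Y \<in> KH_obj U \<and> (\<exists>f. continuous_map X Y f \<and> a = kmap X Y f)"
proof -
  have "continuous_map X Y (restrict f (topspace X))" if "continuous_map X Y f" for f
    using that by (rule continuous_map_eq) simp
  then show ?thesis
    by (auto simp: hom_def opposite_def KH_def kmap_def extensional_restrict intro!: exI)
qed

lemma kmap_in_hom:
  assumes "X \<in> KH_obj U" "Y \<in> KH_obj U" "continuous_map X Y f"
  shows "kmap X Y f \<in> hom (opposite (KH U)) Y X"
  using assms by (auto simp: hom_opposite_KH)

text \<open>In the opposite category the map applied first is written first. Continuity puts the
  values of \<open>f\<close> into \<open>Y\<close>, where restricting \<open>g\<close> changes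
  nothing.\<close>

lemma Comp_kmap:
  assumes "continuous_map X Y f"
  shows "Comp (opposite (KH U)) (kmap X Y f) (kmap Y Z g) = kmap X Z (g \<circ> f)"
  using continuous_map_image_subset_topspace[OF assms]
  by (auto simp: opposite_def KH_def kmap_def compose_def fun_eq_iff restrict_def)

lemma Obj_opposite_KH: "Obj (opposite (KH U)) = KH_obj U"
  by (simp add: opposite_def KH_def)

lemma Id_opposite_KH: "Id (opposite (KH U)) X = kmap X X id"
  by (simp add: opposite_def KH_def kmap_def id_def)

lemma KH_obj_subtopology:
  assumes "X \<in> KH_obj U" "closedin X S"
  shows "subtopology X S \<in> KH_obj U"
proof -
  have "|topspace (subtopology X S)| \<le>o |topspace X|"
    by (simp add: card_of_mono1)
  then have "small U (topspace (subtopology X S))"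
    using assms(1) ordLeq_ordLess_trans by (fastforce simp: KH_obj_def small_def)
  then show ?thesis
    using assms by (auto simp: KH_obj_def Hausdorff_space_subtopology closedin_compact_space compact_space_subtopology)
qed

lemma KH_obj_singleton:
  assumes "universe TYPE('u)"
  shows "discrete_topology {a :: 'u} \<in> KH_obj TYPE('u)"
  by (simp add: KH_obj_def small_finite[OF assms] compact_space_discrete_topology Hausdorff_space_discrete_topology)

section \<open>A point as the limit of a shrinking sequence of closed subspaces\<close>

text \<open>The injection \<open>e\<close> moves the index chain of naturals into \<open>'u\<close>,
  where index sets of colimits must live; \<open>a\<close> is the element of the one-point
  space.\<close>

locale shrinking =
  fixes X :: "'u topology" and N :: "nat \<Rightarrow> 'u set" and p a :: 'u and e :: "nat \<Rightarrow> 'u"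
  assumes U: "universe TYPE('u)" and X: "X \<in> KH_obj TYPE('u)"
    and N: "\<And>n. closedin X (N n)" and dec: "\<And>m n. m \<le> n \<Longrightarrow> N n \<subseteq> N m"
    and Inter: "(\<Inter>n. N n) = {p}" and e: "inj e"
begin

abbreviation (input) "K \<equiv> opposite (KH TYPE('u))"
abbreviation "pt \<equiv> discrete_topology {a}"

definition "I = range e"
definition "r = {(e m, e n) | m n. m \<le> n}"
definition "Do i = subtopology X (N (inv e i))"
text \<open>For \<open>i\<close> below \<open>j\<close> this is the inclusion of the smaller space
  \<open>Do j\<close> into \<open>Do i\<close>, which the opposite category reads as an arrow from
  \<open>Do i\<close> to \<open>Do j\<close>.\<close>

definition "Da i j = kmap (Do j) (Do i) id"
definition "pr i = kmap pt (Do i) (\<lambda>_. p)"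

lemma Do_obj: "Do i \<in> KH_obj TYPE('u)"
  by (simp add: Do_def KH_obj_subtopology X N)

lemma topspace_Do: "topspace (Do (e n)) = N n"
  using closedin_subset[OF N[of n]] e by (auto simp: Do_def)

lemma cont_incl: "m \<le> n \<Longrightarrow> continuous_map (Do (e n)) (Do (e m)) id"
  using dec[of m n] e
  by (auto simp: Do_def continuous_map_in_subtopology continuous_map_from_subtopology)

lemma cont_point: "t \<in> N n \<Longrightarrow> continuous_map pt (Do (e n)) (\<lambda>_. t)"
  by (simp add: topspace_Do)

lemma p_in: "p \<in> N n"
  using Inter by blast

lemma small_I: "small TYPE('u) I"
  using U unfolding universe_def small_def I_def
  by (meson card_of_image ordLeq_ordLess_trans)

lemma directed: "directed_poset natLeq I r"
proof -
  have "partial_order_on I r"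
    unfolding partial_order_on_def preorder_on_def refl_on_def trans_def antisym_def I_def r_def
    by (auto simp: inj_eq[OF e])
  moreover have "\<exists>b\<in>I. \<forall>s\<in>S. (s, b) \<in> r" if S: "S \<subseteq> I" "|S| <o natLeq" for S
  proof -
    have "finite S"
      using S(2) by (simp add: finite_iff_ordLess_natLeq)
    then obtain F where F: "finite F" "S = e ` F"
      using S(1) finite_subset_image[of S e UNIV] unfolding I_def by metis
    \<comment> \<open>Inserting 0 provides an upper bound for the empty \<open>S\<close> as
      well.\<close>
    then show ?thesis
      by (intro bexI[of _ "e (Max (insert 0 F))"]) (auto simp: I_def r_def inj_eq[OF e])
  qed
  ultimately show ?thesis
    by (simp add: directed_poset_def)
qed

lemma diagram: "diagram K I r Do Da"
  unfolding diagram_def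
  by (auto simp: Obj_opposite_KH Do_obj Da_def r_def Id_opposite_KH Comp_kmap cont_incl
      intro!: kmap_in_hom dest: injD[OF e])

text \<open>Compatible maps from \<open>Z\<close> into all the subspaces have the same values, which
  lie in every \<open>N n\<close> and hence equal \<open>p\<close>. So they factor through the
  one-point space, and uniquely, since only one map goes there.\<close>

lemma colimit: "colimit K I r Do Da pt pr"
  unfolding colimit_def
proof (intro conjI allI impI)
  have pr: "pr (e n) \<in> hom K (Do (e n)) pt" for n
    unfolding pr_def by (intro kmap_in_hom KH_obj_singleton U Do_obj cont_point p_in)
  then show "cocone K I r Do Da pt pr"
    using KH_obj_singleton[OF U, of a] Comp_kmap[OF cont_point[OF p_in]]
    by (auto simp: cocone_def Obj_opposite_KH I_def r_def pr_def Da_def comp_def)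
  fix Z d
  assume d: "cocone K I r Do Da Z d"
  then have Z: "Z \<in> KH_obj TYPE('u)"
    by (simp add: cocone_def Obj_opposite_KH)
  have "\<exists>f. continuous_map Z (Do (e n)) f \<and> d (e n) = kmap Z (Do (e n)) f" for n
    using d by (auto simp: cocone_def I_def hom_opposite_KH)
  then obtain f where f: "\<And>n. continuous_map Z (Do (e n)) (f n)" "\<And>n. d (e n) = kmap Z (Do (e n)) (f n)"
    by metis
  have f0: "f n z = f 0 z" if "z \<in> topspace Z" for n z
  proof -
    have "Comp K (d (e n)) (Da (e 0) (e n)) = d (e 0)"
      using d unfolding cocone_def r_def by blast
    then show ?thesis
      using that by (simp add: f Da_def Comp_kmap[OF f(1)] kmap_eq_iff)
  qed
  have fp: "f n z = p" if "z \<in> topspace Z" for n z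
  proof -
    have "f 0 z \<in> N m" for m
      using f0[OF that, of m] continuous_map_image_subset_topspace[OF f(1)[of m]] that
      by (auto simp: topspace_Do)
    then have "f 0 z = p"
      using Inter by blast
    then show ?thesis
      using f0[OF that, of n] by simp
  qed
  have cont: "continuous_map Z pt (\<lambda>_. a)"
    by simp
  show "\<exists>!h. h \<in> hom K pt Z \<and> (\<forall>i\<in>I. Comp K h (pr i) = d i)"
  proof (rule ex1I[of _ "kmap Z pt (\<lambda>_. a)"])
    show "kmap Z pt (\<lambda>_. a) \<in> hom K pt Z \<and> (\<forall>i\<in>I. Comp K (kmap Z pt (\<lambda>_. a)) (pr i) = d i)"
      using KH_obj_singleton[OF U] Z cont
      by (auto simp: I_def pr_def Comp_kmap[OF cont] f kmap_eq_iff fp intro!: kmap_in_hom)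
  next
    fix h
    assume "h \<in> hom K pt Z \<and> (\<forall>i\<in>I. Comp K h (pr i) = d i)"
    then obtain g where "continuous_map Z pt g" "h = kmap Z pt g"
      by (auto simp: hom_opposite_KH)
    then show "h = kmap Z pt (\<lambda>_. a)"
      using continuous_map_image_subset_topspace by (fastforce simp: kmap_eq_iff)
  qed
qed

text \<open>By \<open>N0\<close> the space \<open>X\<close> is the stage \<open>e 0\<close> of the
  chain, so \<open>presentable_colimit_eq\<close> applies to \<open>y\<close> and its composite with
  the constant map at \<open>p\<close>.\<close>

lemma locally_constant:
  assumes F: "is_functor K L Fo Fa" and pres: "preserves_directed_colimits TYPE('u) natLeq K L Fo Fa"
    and A: "presentable TYPE('u) natLeq L A" and y: "y \<in> hom L A (Fo X)"
    and N0: "N 0 = topspace X"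
  shows "\<exists>n. \<forall>t\<in>N n. Comp L (Fa (kmap pt X (\<lambda>_. t))) y = Comp L (Fa (kmap pt X (\<lambda>_. p))) y"
proof -
  let ?\<pi> = "kmap X X (\<lambda>_. p)"
  have L: "category L"
    using F by (simp add: is_functor_def)
  have Do0: "Do (e 0) = X"
    using e by (simp add: Do_def N0)
  have pX: "p \<in> topspace X"
    using p_in[of 0] N0 by simp
  have \<pi>: "?\<pi> \<in> hom K X X"
    using X pX by (intro kmap_in_hom) auto
  have point: "kmap pt (Do (e n)) (\<lambda>_. t) \<in> hom K (Do (e n)) pt" if "t \<in> N n" for t n
    using that by (intro kmap_in_hom KH_obj_singleton U Do_obj cont_point)
  \<comment> \<open>For \<open>t = p\<close> this yields the agreement in the colimit; for
    \<open>t\<close> in \<open>N n\<close> it evaluates the colour at the end.\<close>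
  have collapse: "Comp K (kmap pt X (\<lambda>_. t)) ?\<pi> = kmap pt X (\<lambda>_. p)" if "t \<in> topspace X" for t
    using that by (simp add: Comp_kmap comp_def)
  have pr0: "kmap pt X (\<lambda>_. t) \<in> hom K X pt" if "t \<in> topspace X" for t
    using point[of t 0] that by (simp add: Do0 N0)
  have \<pi>y: "Comp L (Fa ?\<pi>) y \<in> hom L A (Fo X)"
    using Comp_in_hom[OF L y] F \<pi> unfolding is_functor_def by blast
  have "colimit L I r (\<lambda>i. Fo (Do i)) (\<lambda>i j. Fa (Da i j)) (Fo pt) (\<lambda>i. Fa (pr i))"
    using pres small_I directed diagram colimit unfolding preserves_directed_colimits_def by blast
  moreover have "Comp L (Fa (pr (e 0))) y = Comp L (Fa (pr (e 0))) (Comp L (Fa ?\<pi>) y)"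
    using functor_Comp[OF F \<pi> pr0[OF pX] y] collapse[OF pX] by (simp add: pr_def Do0)
  moreover have "y \<in> hom L A (Fo (Do (e 0)))" "Comp L (Fa ?\<pi>) y \<in> hom L A (Fo (Do (e 0)))"
    using y \<pi>y by (simp_all add: Do0)
  moreover have "e 0 \<in> I"
    by (simp add: I_def)
  ultimately obtain j where j: "(e 0, j) \<in> r"
    "Comp L (Fa (Da (e 0) j)) y = Comp L (Fa (Da (e 0) j)) (Comp L (Fa ?\<pi>) y)"
    using presentable_colimit_eq[OF U L small_I directed functor_diagram[OF F diagram] _ A] by blast
  then obtain n where n: "j = e n"
    by (auto simp: r_def)
  have incl: "Da (e 0) (e n) \<in> hom K X (Do (e n))"
    using diagram j by (auto simp: diagram_def n Do0)
  have "Comp L (Fa (kmap pt X (\<lambda>_. t))) y = Comp L (Fa (kmap pt X (\<lambda>_. p))) y"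
    if t: "t \<in> N n" for t
  proof -
    have tX: "t \<in> topspace X"
      using t dec[of 0 n] by (auto simp: N0)
    \<comment> \<open>The point \<open>t\<close> of \<open>X\<close> factors through
      \<open>N n\<close>, so its colour can be computed at stage \<open>n\<close>, where
      \<open>y\<close> and its composite with the constant map agree.\<close>
    let ?t = "kmap pt (Do (e n)) (\<lambda>_. t)"
    have eq: "Comp K ?t (Da (e 0) (e n)) = kmap pt X (\<lambda>_. t)"
      using Comp_kmap[OF cont_point[OF t]] by (simp add: Da_def Do0 comp_def)
    have "Comp L (Fa (kmap pt X (\<lambda>_. t))) y = Comp L (Fa ?t) (Comp L (Fa (Da (e 0) (e n))) y)"
      using functor_Comp[OF F incl point[OF t] y] eq by simp
    also have "\<dots> = Comp L (Fa ?t) (Comp L (Fa (Da (e 0) (e n))) (Comp L (Fa ?\<pi>) y))"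
      using j n by simp
    also have "\<dots> = Comp L (Fa (kmap pt X (\<lambda>_. t))) (Comp L (Fa ?\<pi>) y)"
      using functor_Comp[OF F incl point[OF t] \<pi>y] eq by simp
    also have "\<dots> = Comp L (Fa (kmap pt X (\<lambda>_. p))) y"
      using functor_Comp[OF F \<pi> pr0[OF tX] y] collapse[OF tX] by simp
    finally show ?thesis .
  qed
  then show ?thesis
    by blast
qed

end

section \<open>A copy of the unit interval in the universe\<close>

text \<open>The reals inject into the power set of a copy of the naturals inside \<open>'u\<close>,
  and that power set is small.\<close>

lemma universe_real:
  assumes "universe TYPE('u)"
  obtains g :: "real \<Rightarrow> 'u" where "inj g" "small TYPE('u) (range g)"
proof -
  have nat: "|UNIV :: nat set| \<le>o |UNIV :: 'u set|"
    using assms by (simp add: universe_def small_def ordLess_imp_ordLeq)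
  then obtain e :: "nat \<Rightarrow> 'u" where e: "inj e"
    by (metis card_of_ordLeq)
  have "|range e| <o |UNIV :: 'u set|"
    using assms unfolding universe_def small_def by (meson card_of_image ordLeq_ordLess_trans)
  then have Pow: "|Pow (range e)| <o |UNIV :: 'u set|"
    using assms unfolding universe_def small_def by blast
  obtain b :: "real \<Rightarrow> nat set" where b: "inj b"
    using nat_sets_eqpoll_reals eqpoll_sym unfolding eqpoll_def bij_betw_def by metis
  have "inj (\<lambda>x. e ` b x)"
    using e b by (auto simp: inj_def inj_image_eq_iff)
  then have "|UNIV :: real set| \<le>o |Pow (range e)|"
    by (intro card_of_ordLeqI[of "\<lambda>x. e ` b x"]) auto
  then have real: "|UNIV :: real set| <o |UNIV :: 'u set|"
    using Pow ordLeq_ordLess_trans by blast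
  then obtain g :: "real \<Rightarrow> 'u" where g: "inj g"
    by (metis card_of_ordLeq ordLess_imp_ordLeq)
  have "small TYPE('u) (range g)"
    unfolding small_def using card_of_image real ordLeq_ordLess_trans by blast
  with g show thesis
    by (rule that)
qed

text \<open>For positive \<open>n\<close> these are the closed neighbourhoods of radius
  \<open>1/n\<close>. The product form makes index 0 give the whole interval, as
  \<open>locally_constant\<close> demands.\<close>

lemma shrinking_interval:
  fixes g :: "real \<Rightarrow> 'u"
  assumes U: "universe TYPE('u)" and g: "inj g" and hom: "homeomorphic_map (top_of_set {0..1}) X g"
    and X: "X \<in> KH_obj TYPE('u)" and p: "p \<in> {0..1}"
  shows "shrinking X (\<lambda>n. g ` {t \<in> {0..1}. \<bar>t - p\<bar> * real n \<le> 1}) (g p) (g \<circ> real)"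
proof
  fix n
  have "closed {t \<in> {0..1}. \<bar>t - p\<bar> * real n \<le> 1}"
    unfolding atLeastAtMost_iff by (intro closed_Collect_conj closed_Collect_le continuous_intros)
  then have "closedin (top_of_set {0..1}) {t \<in> {0..1}. \<bar>t - p\<bar> * real n \<le> 1}"
    by (intro closed_subset) auto
  then show "closedin X (g ` {t \<in> {0..1}. \<bar>t - p\<bar> * real n \<le> 1})"
    using homeomorphic_map_closedness_eq[OF hom] by blast
next
  fix m n :: nat assume "m \<le> n"
  then have "\<bar>t - p\<bar> * real m \<le> \<bar>t - p\<bar> * real n" for t
    by (intro mult_left_mono) auto
  then show "g ` {t \<in> {0..1}. \<bar>t - p\<bar> * real n \<le> 1} \<subseteq> g ` {t \<in> {0..1}. \<bar>t - p\<bar> * real m \<le> 1}"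
    by (intro image_mono) (auto intro: order_trans)
next
  have "(\<Inter>n. {t \<in> {0..1}. \<bar>t - p\<bar> * real n \<le> 1}) = {p}"
  proof (intro equalityI subsetI)
    fix t assume t: "t \<in> (\<Inter>n. {t \<in> {0..1}. \<bar>t - p\<bar> * real n \<le> 1})"
    show "t \<in> {p}"
    proof (rule ccontr)
      assume "t \<notin> {p}"
      then obtain n where "1 < real n * \<bar>t - p\<bar>"
        using reals_Archimedean3[of "\<bar>t - p\<bar>"] by auto
      with t show False
        by (auto simp: mult.commute not_less[symmetric])
    qed
  qed (use p in auto)
  then show "(\<Inter>n. g ` {t \<in> {0..1}. \<bar>t - p\<bar> * real n \<le> 1}) = {g p}"
    by (subst image_INT[OF g, symmetric]) auto
next
  show "inj (g \<circ> real)"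
    using g by (simp add: inj_compose inj_of_nat)
qed (use U X in auto)

theorem corollary24:
  assumes "universe TYPE('u)"
  shows "\<not> abstract_elementary_category TYPE('u) (opposite (KH TYPE('u)))"
proof
  let ?K = "opposite (KH TYPE('u))"
  assume "abstract_elementary_category TYPE('u) ?K"
  then obtain L :: "('u, 'u) cat" and Fo Fa where L: "finitely_accessible TYPE('u) L"
    and emb: "embedding ?K L Fo Fa"
    and pres: "preserves_directed_colimits TYPE('u) natLeq ?K L Fo Fa"
    unfolding abstract_elementary_category_def by blast
  have F: "is_functor ?K L Fo Fa" and faith: "faithful ?K Fa" and cat: "category L"
    using emb by (simp_all add: embedding_def is_functor_def)
  obtain g :: "real \<Rightarrow> 'u" where g: "inj g" "small TYPE('u) (range g)"
    using universe_real[OF assms] .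
  \<comment> \<open>A copy of \<open>[0, 1]\<close> with points in \<open>'u\<close>: pulling the
    topology back along \<open>inv g\<close> makes \<open>g\<close> a homeomorphism.\<close>
  define X where "X = pullback_topology (g ` {0..1}) (inv g) euclideanreal"
  define pt where "pt = discrete_topology {g 0}"
  have "continuous_map (top_of_set {0..1}) X g"
    unfolding X_def using g(1) by (intro continuous_map_pullback') (auto simp: comp_def continuous_map_from_subtopology)
  moreover have "continuous_map X (top_of_set {0..1}) (inv g)"
    using continuous_map_pullback[OF continuous_map_id, of "g ` {0..1}" "inv g" euclideanreal] g(1)
    by (auto simp: continuous_map_in_subtopology X_def topspace_pullback_topology)
  moreover have top: "topspace X = g ` {0..1}"
    by (simp add: X_def topspace_pullback_topology)
  ultimately have maps: "homeomorphic_maps (top_of_set {0..1}) X g (inv g)"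
    using g(1) by (auto simp: homeomorphic_maps_def)
  then have hom: "homeomorphic_map (top_of_set {0..1}) X g"
    using homeomorphic_maps_map by blast
  have space: "top_of_set {0..1::real} homeomorphic_space X"
    using maps homeomorphic_space_def by blast
  have "|topspace X| \<le>o |range g|"
    unfolding top by (intro card_of_mono1) auto
  then have "small TYPE('u) (topspace X)"
    using g(2) ordLeq_ordLess_trans unfolding small_def by blast
  moreover have "compact_space X"
    using homeomorphic_compact_space[OF space] by (simp add: compact_space_subtopology)
  moreover have "Hausdorff_space X"
    using homeomorphic_Hausdorff_space[OF space] Hausdorff_space_subtopology Hausdorff_space_euclidean by metis
  ultimately have X: "X \<in> KH_obj TYPE('u)"
    by (simp add: KH_obj_def)
  have pt: "pt \<in> KH_obj TYPE('u)"
    unfolding pt_def by (rule KH_obj_singleton[OF assms])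
  define P where "P t = kmap pt X (\<lambda>_. g t)" for t
  have P: "P t \<in> hom ?K X pt" if "t \<in> {0..1}" for t
    unfolding P_def using that by (intro kmap_in_hom X pt) (auto simp: top)
  \<comment> \<open>The colour of \<open>P t\<close> is locally constant in \<open>t\<close>, and
    \<open>[0, 1]\<close> is connected.\<close>
  have same_colour: "Comp L (Fa (P 0)) y = Comp L (Fa (P 1)) y"
    if A: "presentable TYPE('u) natLeq L A" and y: "y \<in> hom L A (Fo X)" for A y
  proof (rule connected_local_const[of "{0..1::real}" 0 1])
    show "\<forall>p\<in>{0..1}. \<forall>\<^sub>F t in at p within {0..1}. Comp L (Fa (P p)) y = Comp L (Fa (P t)) y"
    proof
      fix p :: real assume p: "p \<in> {0..1}"
      interpret shrinking X "\<lambda>n. g ` {t \<in> {0..1}. \<bar>t - p\<bar> * real n \<le> 1}" "g p" "g 0" "g \<circ> real"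
        by (rule shrinking_interval[OF assms g(1) hom X p])
      have "g ` {t \<in> {0..1}. \<bar>t - p\<bar> * real 0 \<le> 1} = topspace X"
        unfolding top by (rule image_cong) auto
      from locally_constant[OF F pres A y this]
      obtain n where n: "\<forall>t\<in>{0..1}. \<bar>t - p\<bar> * real n \<le> 1 \<longrightarrow> Comp L (Fa (P t)) y = Comp L (Fa (P p)) y"
        unfolding P_def pt_def by blast
      \<comment> \<open>As \<open>n\<close> may be 0, the radius is
        \<open>1 / (real n + 1)\<close>.\<close>
      have "\<bar>t - p\<bar> * real n \<le> 1" if "dist t p < 1 / (real n + 1)" for t
      proof -
        have "\<bar>t - p\<bar> * (real n + 1) < 1"
          using that by (simp add: dist_real_def field_simps)
        then show ?thesis
          using abs_ge_zero[of "t - p"] by (simp add: distrib_left)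
      qed
      then show "\<forall>\<^sub>F t in at p within {0..1}. Comp L (Fa (P p)) y = Comp L (Fa (P t)) y"
        unfolding eventually_at using n by (intro exI[of _ "1 / (real n + 1)"]) auto
    qed
  qed auto
  have FP: "Fa (P t) \<in> hom L (Fo X) (Fo pt)" if "t \<in> {0..1}" for t
    using F P[OF that] unfolding is_functor_def by blast
  have "Fo X \<in> Obj L"
    using F X unfolding is_functor_def Obj_opposite_KH by blast
  then obtain Q and I :: "'u set" and r Do Da c where
    Q: "\<forall>A\<in>Q. presentable TYPE('u) natLeq L A" "\<forall>i\<in>I. Do i \<in> Q"
    and dir: "directed_poset natLeq I r" and dia: "diagram L I r Do Da"
    and col: "colimit L I r Do Da (Fo X) c"
    using L unfolding finitely_accessible_def accessible_at_def by metis
  \<comment> \<open>Each leg \<open>c i\<close> starts at a presentable object, so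
    \<open>same_colour\<close> applies with \<open>y = c i\<close>.\<close>
  have "Fa (P 0) = Fa (P 1)"
  proof (rule colimit_jointly_epic[OF cat dia col _ FP FP])
    show "r \<subseteq> I \<times> I"
      using dir unfolding directed_poset_def partial_order_on_def preorder_on_def refl_on_def by blast
    show "Comp L (Fa (P 0)) (c i) = Comp L (Fa (P 1)) (c i)" if "i \<in> I" for i
      using same_colour Q that col unfolding colimit_def cocone_def by blast
  qed auto
  \<comment> \<open>Faithfulness identifies the end points themselves, against the injectivity of
    \<open>g\<close>.\<close>
  then have "P 0 = P 1"
    using faith P X pt unfolding faithful_def Obj_opposite_KH
    by (meson atLeastAtMost_iff inj_onD order_refl zero_le_one)
  then show False
    using injD[OF g(1), of 0 1] by (simp add: P_def kmap_eq_iff pt_def)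
qed

end
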